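(* Suppose that there exist (1) an $(s,t)$-regular $(m,n,k,\lambda_a,1)$-OOSPC with $b_1$ codewords; and (2) an $(s,t,k,\lambda_a,1)$-OOSPC with $b_2$ codewords. Then there exists an $(m,n,k,\lambda_a,1)$-OOSPC with $b_1+b_2$ codewords. Furthermore, if the given $(s,t,k,\lambda_a,1)$-OOSPC is $(g,h)$-regular, then the resulting $(m,n,k,\lambda_a,1)$-OOSPC is $(g,h)$-regular.
   Context: For positive integers $m,n,k,\lambda_a,\lambda_c$, an $(m,n,k,\lambda_a,\lambda_c)$-OOSPC (optical orthogonal signature pattern code) is a set $\mathcal F$ of $k$-subsets (codewords) of $\mathbb{Z}_m\times\mathbb{Z}_n$ such that (1) $|X\cap (X+g)|\le\lambda_a$ for every $X\in\mathcal F$ and every $g\in\mathbb{Z}_m\times\mathbb{Z}_n\setminus\{(0,0)\}$; (2) $|X\cap(Y+g)|\le\lambda_c$ for all distinct $X,Y\in\mathcal F$ and every $g\in\mathbb{Z}_m\times\mathbb{Z}_n$. For a codeword $X$, $\mathrm{supp}(\Delta X)$ is the set of all differences $x-y$ with $x,y\in X$, $x\ne y$. The (difference) leave of an $(m,n,k,\lambda_a,1)$-OOSPC $\mathcal F$ is the set of all nonzero elements of $\mathbb{Z}_m\times\mathbb{Z}_n$ not in $\bigcup_{X\in\mathcal F}\mathrm{supp}(\Delta X)$. $\mathcal F$ is $(s,t)$-regular if its leave together with $(0,0)$ equals $S\times T$, where $S$ is the subgroup of order $s$ of $\mathbb{Z}_m$ and $T$ is the subgroup of order $t$ of $\mathb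b{Z}_n$.
   Formalization: The codeword size k is assumed to be at least 2; for k = 1 the claim fails, since the set of all mn singletons is (m,n)-regular and there cannot be 2mn distinct codewords. *)

theory Defs
  imports "HOL-Algebra.Elementary_Groups"
begin

text \<open>The additive group \<open>\<int>\<^sub>m \<times> \<int>\<^sub>n\<close>, written multiplicatively as in HOL-Algebra: \<open>\<otimes>\<close> is addition,
  \<open>x \<otimes> inv y\<close> is \<open>x - y\<close>, \<open>\<one>\<close> is \<open>(0,0)\<close>, and the right coset \<open>X #> g\<close> is the translate \<open>X + g\<close>.
  The library's \<open>integer_mod_group 0\<close> is \<open>\<int>\<close>; the positivity conditions below exclude that case.\<close>

abbreviation ZZ :: "nat \<Rightarrow> nat \<Rightarrow> (int \<times> int) monoid" where
  "ZZ m n \<equiv> integer_mod_group m \<times>\<times> integer_mod_group n"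

definition oospc :: "nat \<Rightarrow> nat \<Rightarrow> nat \<Rightarrow> nat \<Rightarrow> nat \<Rightarrow> (int \<times> int) set set \<Rightarrow> bool" where
  "oospc m n k la lc F \<longleftrightarrow>
     0 < m \<and> 0 < n \<and> 0 < k \<and> 0 < la \<and> 0 < lc \<and>
     (\<forall>X\<in>F. X \<subseteq> carrier (ZZ m n) \<and> card X = k) \<and>
     (\<forall>X\<in>F. \<forall>g\<in>carrier (ZZ m n) - {\<one>\<^bsub>ZZ m n\<^esub>}. card (X \<inter> (X #>\<^bsub>ZZ m n\<^esub> g)) \<le> la) \<and>
     (\<forall>X\<in>F. \<forall>Y\<in>F. X \<noteq> Y \<longrightarrow>
        (\<forall>g\<in>carrier (ZZ m n). card (X \<inter> (Y #>\<^bsub>ZZ m n\<^esub> g)) \<le> lc))"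

definition supp_diff :: "nat \<Rightarrow> nat \<Rightarrow> (int \<times> int) set \<Rightarrow> (int \<times> int) set" where
  "supp_diff m n X = {x \<otimes>\<^bsub>ZZ m n\<^esub> inv\<^bsub>ZZ m n\<^esub> y | x y. x \<in> X \<and> y \<in> X \<and> x \<noteq> y}"

definition leave :: "nat \<Rightarrow> nat \<Rightarrow> (int \<times> int) set set \<Rightarrow> (int \<times> int) set" where
  "leave m n F = carrier (ZZ m n) - {\<one>\<^bsub>ZZ m n\<^esub>} - (\<Union>X\<in>F. supp_diff m n X)"

text \<open>For \<open>m, n > 0\<close> the subgroups \<open>S\<close> and \<open>T\<close> are unique when they exist, since finite cyclic
  groups have at most one subgroup of each order.\<close>

definition oospc_regular :: "nat \<Rightarrow> nat \<Rightarrow> nat \<Rightarrow> nat \<Rightarrow> (int \<times> int) set set \<Rightarrow> bool" where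
  "oospc_regular m n s t F \<longleftrightarrow>
     (\<exists>S T. subgroup S (integer_mod_group m) \<and> card S = s \<and>
            subgroup T (integer_mod_group n) \<and> card T = t \<and>
            insert \<one>\<^bsub>ZZ m n\<^esub> (leave m n F) = S \<times> T)"

end

theory Submission
  imports Defs "HOL-Algebra.Multiplicative_Group"
begin

text \<open>Multiplication by \<open>m div s\<close> embeds \<open>\<int>\<^sub>s\<close> into \<open>\<int>\<^sub>m\<close> with image the subgroup of order \<open>s\<close>, so
  \<open>\<int>\<^sub>s \<times> \<int>\<^sub>t\<close> embeds onto \<open>S \<times> T\<close> by a map \<open>h\<close>. Add the images under \<open>h\<close> of the
  small codewords to the big code. All differences of these images lie in \<open>S \<times> T\<close>, hence are not
  differences of the big code, and two translates can only meet twice if they share a difference.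
  The leave of the union is the \<open>h\<close>-image of the leave of the small code.\<close>

section \<open>Subgroups of finite cyclic groups\<close>

lemma integer_mod_group_subgroup_embedding:
  assumes S: "subgroup S (integer_mod_group m)" "card S = s" and "0 < m"
  obtains f where "f \<in> mon (integer_mod_group s) (integer_mod_group m)"
    and "f ` carrier (integer_mod_group s) = S"
proof -
  interpret M: group "integer_mod_group m" by simp
  interpret S: group "integer_mod_group m\<lparr>carrier := S\<rparr>"
    using M.subgroup_imp_group S(1) .
  have carr: "carrier (integer_mod_group m) = {0..<int m}"
    using \<open>0 < m\<close> by (simp add: carrier_integer_mod_group)
  have SM: "S \<subseteq> {0..<int m}" using subgroup.subset[OF S(1)] carr by simp
  have "finite S" using SM finite_subset by blast
  moreover have "S \<noteq> {}" using subgroup.one_closed[OF S(1)] by blast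
  \<comment> \<open>Positivity of \<open>s\<close> matters because
    \<open>integer_mod_group 0\<close> is the group of all integers, not a finite cyclic
    group.\<close>
  ultimately have "0 < s" by (simp add: card_gt_0_iff flip: S(2))
  have "card (rcosets\<^bsub>integer_mod_group m\<^esub> S) * s = m"
    using M.lagrange_finite[OF _ S(1)] S(2) by (simp add: carr order_def)
  then have "s dvd m" by (metis dvd_triv_right)
  then obtain d where d: "m = d * s" by (metis dvd_div_mult_self)
  with \<open>0 < m\<close> have "0 < d" by simp
  \<comment> \<open>No reduction modulo \<open>m\<close> is needed: \<open>0 \<le> x < s\<close>
    gives \<open>0 \<le> d * x < d * s = m\<close>.\<close>
  define f where "f = (\<lambda>x::int. int d * x)"
  have cs: "carrier (integer_mod_group s) = {0..<int s}"
    using \<open>0 < s\<close> by (simp add: carrier_integer_mod_group)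
  have inj: "inj_on f A" for A using \<open>0 < d\<close> by (auto simp: f_def inj_on_def)
  have "f \<in> hom (integer_mod_group s) (integer_mod_group m)"
  proof (rule homI)
    fix x assume "x \<in> carrier (integer_mod_group s)"
    then show "f x \<in> carrier (integer_mod_group m)"
      using \<open>0 < d\<close> unfolding cs carr by (simp add: f_def d)
  next
    fix x y
    have "f ((x + y) mod int s) = (f x + f y) mod int m"
      unfolding f_def d of_nat_mult mult_mod_right distrib_left ..
    then show "f (x \<otimes>\<^bsub>integer_mod_group s\<^esub> y) = f x \<otimes>\<^bsub>integer_mod_group m\<^esub> f y" by simp
  qed
  then have mon: "f \<in> mon (integer_mod_group s) (integer_mod_group m)"
    using inj by (simp add: mon_def)
  \<comment> \<open>In the group \<open>S\<close> of order \<open>s\<close> every \<open>x\<close>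
    satisfies \<open>s * x = 0\<close> modulo \<open>m = d * s\<close>, so \<open>d\<close> divides
    \<open>x\<close>. Equality with the image then follows by counting, both sets having
    \<open>s\<close> elements.\<close>
  have "S \<subseteq> f ` {0..<int s}"
  proof
    fix x assume x: "x \<in> S"
    have "x [^]\<^bsub>integer_mod_group m\<lparr>carrier := S\<rparr>\<^esub> s = 0"
      using S.pow_order_eq_1[of x] x S(2) by (simp add: order_def)
    then have "x [^]\<^bsub>integer_mod_group m\<^esub> s = 0"
      by (simp add: nat_pow_def)
    then have "int m dvd int s * x" by (simp add: mod_eq_0_iff_dvd)
    then have "int d dvd x" using \<open>0 < s\<close> by (simp add: d mult.commute)
    then obtain j where j: "x = int d * j" by blast
    have "0 \<le> x" "x < int m" using x SM by auto
    then have "0 \<le> j" "j < int s" using \<open>0 < d\<close> by (auto simp: j d zero_le_mult_iff)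
    then show "x \<in> f ` {0..<int s}" by (auto simp: j f_def)
  qed
  moreover have "card (f ` {0..<int s}) = s" using card_image[OF inj] by simp
  ultimately have "f ` {0..<int s} = S" using S(2) by (metis card_subset_eq finite_imageI finite_atLeastLessThan_int)
  with mon that cs show thesis by simp
qed

section \<open>Intersections of translates\<close>

lemma group_ZZ: "group (ZZ m n)"
  by (simp add: DirProd_group)

lemma finite_carrier_ZZ: "0 < m \<Longrightarrow> 0 < n \<Longrightarrow> finite (carrier (ZZ m n))"
  by (simp add: carrier_integer_mod_group)

text \<open>Two distinct common points \<open>y \<otimes> g\<close> and
  \<open>y' \<otimes> g\<close> have the same difference as \<open>y\<close> and \<open>y'\<close>,
  since \<open>g\<close> cancels; this would be a difference of both \<open>X\<close> and
  \<open>Y\<close>. This reduces cross-correlation 1 to disjointness of difference sets.\<close>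

lemma (in group) rcoset_Int_card_le_1:
  assumes fin: "finite X" and "X \<subseteq> carrier G" "Y \<subseteq> carrier G" "g \<in> carrier G"
    and disj: "\<And>x x' y y'. \<lbrakk>x \<in> X; x' \<in> X; x \<noteq> x'; y \<in> Y; y' \<in> Y; y \<noteq> y'\<rbrakk> \<Longrightarrow> x \<otimes> inv x' \<noteq> y \<otimes> inv y'"
  shows "card (X \<inter> (Y #> g)) \<le> 1"
proof -
  have "x = x'" if x: "x \<in> X \<inter> (Y #> g)" "x' \<in> X \<inter> (Y #> g)" for x x'
  proof (rule ccontr)
    assume ne: "x \<noteq> x'"
    obtain y y' where y: "y \<in> Y" "y' \<in> Y" "x = y \<otimes> g" "x' = y' \<otimes> g"
      using x by (auto simp: r_coset_def)
    then have c: "y \<in> carrier G" "y' \<in> carrier G" using assms by auto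
    have "x \<otimes> inv x' = y \<otimes> inv y'"
      using c assms(4) by (simp add: y inv_mult_group inv_solve_right m_assoc)
    then show False using disj[of x x' y y'] x y ne by blast
  qed
  then show ?thesis using fin card_le_Suc0_iff_eq[of "X \<inter> (Y #> g)"] by auto
qed

text \<open>If \<open>y\<close> and \<open>y \<otimes> g\<close> both lay in the subgroup, so would
  \<open>g\<close>. This disposes of shifts outside the embedded copy of the small group.\<close>

lemma (in group) rcoset_Int_empty:
  assumes "subgroup P G" "X \<subseteq> P" "Y \<subseteq> P" "g \<in> carrier G" "g \<notin> P"
  shows "X \<inter> (Y #> g) = {}"
proof -
  have False if "y \<in> Y" "y \<otimes> g \<in> X" for y
  proof -
    have y: "y \<in> P" "y \<otimes> g \<in> P" using that assms by auto
    then have "inv y \<otimes> (y \<otimes> g) \<in> P"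
      using subgroup.m_closed[OF assms(1)] subgroup.m_inv_closed[OF assms(1)] by blast
    moreover have "inv y \<otimes> (y \<otimes> g) = g"
      using subgroup.mem_carrier[OF assms(1)] y assms(4) by (subst inv_solve_left') auto
    ultimately show False using assms(5) by simp
  qed
  then show ?thesis by (auto simp: r_coset_def)
qed

lemma (in group_hom) image_rcoset:
  assumes "X \<subseteq> carrier G" "g \<in> carrier G"
  shows "h ` X #>\<^bsub>H\<^esub> h g = h ` (X #> g)"
proof -
  have "h x \<otimes>\<^bsub>H\<^esub> h g = h (x \<otimes> g)" if "x \<in> X" for x
    using that assms by (simp add: subset_iff)
  then show ?thesis by (simp add: r_coset_def image_UN)
qed

text \<open>Translation commutes with a homomorphism and intersection with an injection, so for
  shifts inside the image the correlations are those of the small code.\<close>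

lemma card_Int_image_rcoset:
  assumes h: "group_hom G H h" "inj_on h (carrier G)"
    and XY: "X \<subseteq> carrier G" "Y \<subseteq> carrier G" and g: "g \<in> carrier G"
  shows "card (h ` X \<inter> (h ` Y #>\<^bsub>H\<^esub> h g)) = card (X \<inter> (Y #>\<^bsub>G\<^esub> g))"
proof -
  interpret group_hom G H h by fact
  have c: "Y #>\<^bsub>G\<^esub> g \<subseteq> carrier G" using XY g by (simp add: G.r_coset_subset_G)
  have "h ` X \<inter> (h ` Y #>\<^bsub>H\<^esub> h g) = h ` (X \<inter> (Y #>\<^bsub>G\<^esub> g))"
    using image_rcoset[OF XY(2) g] inj_on_image_Int[OF h(2) XY(1) c] by simp
  moreover have "inj_on h (X \<inter> (Y #>\<^bsub>G\<^esub> g))"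
    using h(2) XY(1) by (meson inf.coboundedI1 inj_on_subset)
  ultimately show ?thesis by (simp add: card_image)
qed

section \<open>Difference sets and their images under an embedding\<close>

lemma supp_diff_subset:
  assumes "X \<subseteq> carrier (ZZ m n)"
  shows "supp_diff m n X \<subseteq> carrier (ZZ m n) - {\<one>\<^bsub>ZZ m n\<^esub>}"
proof -
  interpret group "ZZ m n" by (rule group_ZZ)
  show ?thesis
  proof
    fix z assume "z \<in> supp_diff m n X"
    then obtain x y where z: "z = x \<otimes>\<^bsub>ZZ m n\<^esub> inv\<^bsub>ZZ m n\<^esub> y" "x \<in> X" "y \<in> X" "x \<noteq> y"
      unfolding supp_diff_def by blast
    then have c: "x \<in> carrier (ZZ m n)" "y \<in> carrier (ZZ m n)" using assms by auto
    then have "z \<in> carrier (ZZ m n)" unfolding z(1) by (intro m_closed inv_closed)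
    moreover have "z \<noteq> \<one>\<^bsub>ZZ m n\<^esub>"
      using c z(1,4) inv_equality[of x "inv\<^bsub>ZZ m n\<^esub> y"] inv_inv inv_closed by metis
    ultimately show "z \<in> carrier (ZZ m n) - {\<one>\<^bsub>ZZ m n\<^esub>}" by blast
  qed
qed

text \<open>A homomorphism carries differences to differences; injectivity ensures that distinct
  pairs correspond exactly to distinct pairs.\<close>

lemma supp_diff_image:
  assumes h: "group_hom (ZZ s t) (ZZ m n) h" "inj_on h (carrier (ZZ s t))"
    and X: "X \<subseteq> carrier (ZZ s t)"
  shows "supp_diff m n (h ` X) = h ` supp_diff s t X"
proof -
  interpret group_hom "ZZ s t" "ZZ m n" h by fact
  have diff: "h x \<otimes>\<^bsub>ZZ m n\<^esub> inv\<^bsub>ZZ m n\<^esub> (h y) = h (x \<otimes>\<^bsub>ZZ s t\<^esub> inv\<^bsub>ZZ s t\<^esub> y)"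
    if "x \<in> X" "y \<in> X" for x y
  proof -
    have c: "x \<in> carrier (ZZ s t)" "y \<in> carrier (ZZ s t)" using that X by auto
    show ?thesis unfolding hom_mult[OF c(1) G.inv_closed[OF c(2)]] hom_inv[OF c(2)] ..
  qed
  have ne: "h x = h y \<longleftrightarrow> x = y" if "x \<in> X" "y \<in> X" for x y
    using that X h(2) by (meson inj_onD subsetD)
  show ?thesis
  proof (rule Set.set_eqI)
    fix z
    have "z \<in> supp_diff m n (h ` X) \<longleftrightarrow> (\<exists>x\<in>X. \<exists>y\<in>X. z = h x \<otimes>\<^bsub>ZZ m n\<^esub> inv\<^bsub>ZZ m n\<^esub> (h y) \<and> h x \<noteq> h y)"
      unfolding supp_diff_def by blast
    also have "\<dots> \<longleftrightarrow> (\<exists>x\<in>X. \<exists>y\<in>X. z = h (x \<otimes>\<^bsub>ZZ s t\<^esub> inv\<^bsub>ZZ s t\<^esub> y) \<and> x \<noteq> y)"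
      by (intro bex_cong refl) (simp only: diff ne)
    also have "\<dots> \<longleftrightarrow> z \<in> h ` supp_diff s t X"
      unfolding supp_diff_def by blast
    finally show "z \<in> supp_diff m n (h ` X) \<longleftrightarrow> z \<in> h ` supp_diff s t X" .
  qed
qed

lemma supp_diff_nonempty:
  assumes "card X = k" "2 \<le> k"
  shows "supp_diff m n X \<noteq> {}"
proof -
  obtain x y where "x \<in> X" "y \<in> X" "x \<noteq> y"
    \<comment> \<open>An infinite \<open>X\<close> would have \<open>card X = 0\<close>,
      contradicting \<open>2 \<le> k\<close>; so \<open>X\<close> is finite and has more than one
      element.\<close>
    using assms card_le_Suc0_iff_eq[of X] card.infinite[of X]
    by (metis not_less_eq_eq numeral_2_eq_2 not_numeral_le_zero)
  then show ?thesis unfolding supp_diff_def by blast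
qed

section \<open>Leave and code conditions of the enlarged family\<close>

lemma oospc_finite: "oospc m n k la lc F \<Longrightarrow> finite F"
  unfolding oospc_def using finite_carrier_ZZ by (metis Pow_iff finite_Pow_iff finite_subset subsetI)

text \<open>The differences are removed in two stages: those of \<open>F1\<close> leave the nonzero
  part of the image of \<open>h\<close>, and from it the images of the differences of
  \<open>F2\<close> are removed. Injectivity of \<open>h\<close> lets the image commute with set
  difference.\<close>

lemma leave_Un_image:
  assumes h: "group_hom (ZZ s t) (ZZ m n) h" "inj_on h (carrier (ZZ s t))"
    and F1: "insert \<one>\<^bsub>ZZ m n\<^esub> (leave m n F1) = h ` carrier (ZZ s t)"
    and F2: "\<And>X. X \<in> F2 \<Longrightarrow> X \<subseteq> carrier (ZZ s t)"
  shows "leave m n (F1 \<union> image h ` F2) = h ` leave s t F2"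
proof -
  interpret group_hom "ZZ s t" "ZZ m n" h by fact
  have "\<one>\<^bsub>ZZ m n\<^esub> \<notin> leave m n F1" by (simp add: leave_def)
  then have L1: "leave m n F1 = h ` carrier (ZZ s t) - {h \<one>\<^bsub>ZZ s t\<^esub>}"
    using F1 hom_one by (metis Diff_insert_absorb)
  have U: "(\<Union>X\<in>image h ` F2. supp_diff m n X) = h ` (\<Union>X\<in>F2. supp_diff s t X)"
    using supp_diff_image[OF h] F2 by auto
  have sub: "(\<Union>X\<in>F2. supp_diff s t X) \<subseteq> carrier (ZZ s t)"
    using supp_diff_subset F2 by blast
  have "leave m n (F1 \<union> image h ` F2) = leave m n F1 - (\<Union>X\<in>image h ` F2. supp_diff m n X)"
    unfolding leave_def by blast
  also have "\<dots> = h ` carrier (ZZ s t) - h ` {\<one>\<^bsub>ZZ s t\<^esub>} - h ` (\<Union>X\<in>F2. supp_diff s t X)"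
    unfolding L1 U by simp
  also have "\<dots> = h ` leave s t F2"
    unfolding leave_def using sub G.one_closed
    by (simp only: inj_on_image_set_diff[OF h(2)] Diff_subset subset_trans[OF Diff_subset] insert_subset empty_subsetI simp_thms)
  finally show ?thesis .
qed

text \<open>Pairs within \<open>F1\<close> are covered by \<open>F1\<close> itself. Pairs of image
  codewords reduce to \<open>F2\<close> for shifts inside the image and do not meet for shifts
  outside it. Mixed pairs have disjoint difference sets, as differences of image codewords lie in
  the leave of \<open>F1\<close>.\<close>

lemma oospc_Un_image:
  assumes h: "group_hom (ZZ s t) (ZZ m n) h" "inj_on h (carrier (ZZ s t))"
    and k: "2 \<le> k" and F1: "oospc m n k la 1 F1" and F2: "oospc s t k la 1 F2"
    and L: "h ` carrier (ZZ s t) \<subseteq> insert \<one>\<^bsub>ZZ m n\<^esub> (leave m n F1)"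
  shows "oospc m n k la 1 (F1 \<union> image h ` F2)"
    and "card (F1 \<union> image h ` F2) = card F1 + card F2"
proof -
  interpret group_hom "ZZ s t" "ZZ m n" h by fact
  note d1 = F1[unfolded oospc_def] and d2 = F2[unfolded oospc_def]
  have c1: "X \<subseteq> carrier (ZZ m n)" "card X = k" "finite X" if "X \<in> F1" for X
    using that d1 k by (auto intro!: card_ge_0_finite)
  have c2: "X \<subseteq> carrier (ZZ s t)" "card X = k" "finite X" if "X \<in> F2" for X
    using that d2 k by (auto intro!: card_ge_0_finite)
  have hc: "h ` X \<subseteq> h ` carrier (ZZ s t)" "h ` X \<subseteq> carrier (ZZ m n)" "card (h ` X) = k"
    if "X \<in> F2" for X
  proof -
    show "h ` X \<subseteq> h ` carrier (ZZ s t)" using c2(1)[OF that] by (rule image_mono)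
    then show "h ` X \<subseteq> carrier (ZZ m n)" using subgroup.subset[OF img_is_subgroup] by (rule subset_trans)
    show "card (h ` X) = k"
      using card_image[OF inj_on_subset[OF h(2) c2(1)[OF that]]] c2(2)[OF that] by simp
  qed
  have disj: "supp_diff m n X \<inter> supp_diff m n (h ` Y) = {}" if X: "X \<in> F1" and Y: "Y \<in> F2" for X Y
  proof -
    have "supp_diff m n (h ` Y) \<subseteq> h ` carrier (ZZ s t)"
      using supp_diff_image[OF h c2(1)[OF Y]] supp_diff_subset[OF c2(1)[OF Y]] by blast
    \<comment> \<open>Differences are nonzero, so the inserted zero in \<open>L\<close> can be
      discarded.\<close>
    then have "supp_diff m n (h ` Y) \<subseteq> leave m n F1"
      using L supp_diff_subset[OF hc(2)[OF Y]] by blast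
    then show ?thesis using X unfolding leave_def by blast
  qed
  have pos: "0 < m" "0 < n" "0 < k" "0 < la" using d1 by blast+
  have auto1: "card (X \<inter> (X #>\<^bsub>ZZ m n\<^esub> g)) \<le> la"
    if "X \<in> F1" "g \<in> carrier (ZZ m n) - {\<one>\<^bsub>ZZ m n\<^esub>}" for X g
    using d1 that by blast
  have cross1: "card (X \<inter> (Y #>\<^bsub>ZZ m n\<^esub> g)) \<le> 1"
    if "X \<in> F1" "Y \<in> F1" "X \<noteq> Y" "g \<in> carrier (ZZ m n)" for X Y g
    using d1 that by blast
  have auto2: "card (h ` X \<inter> (h ` X #>\<^bsub>ZZ m n\<^esub> g)) \<le> la"
    if X: "X \<in> F2" and g: "g \<in> carrier (ZZ m n) - {\<one>\<^bsub>ZZ m n\<^esub>}" for X g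
  proof (cases "g \<in> h ` carrier (ZZ s t)")
    case True
    then obtain g' where g': "g = h g'" "g' \<in> carrier (ZZ s t)" by blast
    \<comment> \<open>The autocorrelation bound of \<open>F2\<close> holds only for nonzero shifts;
      \<open>g' = 0\<close> would give \<open>g = 0\<close>.\<close>
    with g have "g' \<noteq> \<one>\<^bsub>ZZ s t\<^esub>" using hom_one by blast
    then show ?thesis
      unfolding g'(1) card_Int_image_rcoset[OF h c2(1) c2(1), OF X X g'(2)]
      using d2 X g'(2) by blast
  next
    case False
    then show ?thesis
      using H.rcoset_Int_empty[OF img_is_subgroup hc(1) hc(1), OF X X] g by simp
  qed
  have cross2: "card (h ` X \<inter> (h ` Y #>\<^bsub>ZZ m n\<^esub> g)) \<le> 1"
    if X: "X \<in> F2" and Y: "Y \<in> F2" and "X \<noteq> Y" and g: "g \<in> carrier (ZZ m n)" for X Y g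
  proof (cases "g \<in> h ` carrier (ZZ s t)")
    case True
    then obtain g' where g': "g = h g'" "g' \<in> carrier (ZZ s t)" by blast
    then show ?thesis
      unfolding g'(1) card_Int_image_rcoset[OF h c2(1) c2(1), OF X Y g'(2)]
      using d2 X Y \<open>X \<noteq> Y\<close> by blast
  next
    case False
    then show ?thesis
      using H.rcoset_Int_empty[OF img_is_subgroup hc(1) hc(1), OF X Y] g by simp
  qed
  have cross: "card (X \<inter> (Y #>\<^bsub>ZZ m n\<^esub> g)) \<le> 1"
    if "X \<subseteq> carrier (ZZ m n)" "Y \<subseteq> carrier (ZZ m n)" "card X = k" "g \<in> carrier (ZZ m n)"
      and "supp_diff m n X \<inter> supp_diff m n Y = {}" for X Y g
  proof (rule H.rcoset_Int_card_le_1)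
    show "finite X" using that(3) k by (intro card_ge_0_finite) simp
  qed (use that in \<open>unfold supp_diff_def, blast+\<close>)
  have cross12: "card (X \<inter> (h ` Y #>\<^bsub>ZZ m n\<^esub> g)) \<le> 1" "card (h ` Y \<inter> (X #>\<^bsub>ZZ m n\<^esub> g)) \<le> 1"
    if "X \<in> F1" "Y \<in> F2" "g \<in> carrier (ZZ m n)" for X Y g
    using cross c1 hc disj that by (simp_all add: Int_commute)
  show "oospc m n k la 1 (F1 \<union> image h ` F2)"
    unfolding oospc_def
  proof (intro conjI ballI impI)
    fix X Y g
    assume "X \<in> F1 \<union> image h ` F2" "Y \<in> F1 \<union> image h ` F2" and ne: "X \<noteq> Y" and g: "g \<in> carrier (ZZ m n)"
    then consider "X \<in> F1" "Y \<in> F1" | Y' where "X \<in> F1" "Y' \<in> F2" "Y = h ` Y'"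
      | X' where "X' \<in> F2" "X = h ` X'" "Y \<in> F1"
      | X' Y' where "X' \<in> F2" "X = h ` X'" "Y' \<in> F2" "Y = h ` Y'" by blast
    then show "card (X \<inter> (Y #>\<^bsub>ZZ m n\<^esub> g)) \<le> 1"
    proof cases
      case 1 then show ?thesis using cross1 ne g by blast
    next
      case 2 then show ?thesis using cross12(1) g by blast
    next
      case 3 then show ?thesis using cross12(2) g by blast
    next
      case 4
      then have "X' \<noteq> Y'" using ne by blast
      then show ?thesis using cross2[OF 4(1,3) _ g] 4(2,4) by simp
    qed
  next
    fix X g assume "X \<in> F1 \<union> image h ` F2" and g: "g \<in> carrier (ZZ m n) - {\<one>\<^bsub>ZZ m n\<^esub>}"
    then show "card (X \<inter> (X #>\<^bsub>ZZ m n\<^esub> g)) \<le> la"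
      using auto1[OF _ g] auto2[OF _ g] by (elim UnE imageE) simp_all
  next
    fix X assume "X \<in> F1 \<union> image h ` F2"
    then consider "X \<in> F1" | X' where "X' \<in> F2" "X = h ` X'" by blast
    then have "X \<subseteq> carrier (ZZ m n) \<and> card X = k"
    proof cases
      case 1 then show ?thesis using c1 by simp
    next
      case 2 then show ?thesis using hc(2,3)[OF 2(1)] by simp
    qed
    then show "X \<subseteq> carrier (ZZ m n)" "card X = k" by blast+
  qed (use pos in simp_all)
  \<comment> \<open>A common codeword would have a difference set disjoint from itself, hence empty,
    which \<open>2 \<le> k\<close> excludes. This is what makes the codeword counts add up.\<close>
  have "F1 \<inter> image h ` F2 = {}"
  proof -
    have "h ` Y \<notin> F1" if "Y \<in> F2" for Y
      using disj[OF _ that] supp_diff_nonempty[OF hc(3)[OF that] k] by (metis Int_absorb)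
    then show ?thesis by blast
  qed
  moreover have "inj_on (image h) F2"
    by (rule inj_on_subset[OF inj_on_image_Pow[OF h(2)]]) (use c2(1) in blast)
  ultimately show "card (F1 \<union> image h ` F2) = card F1 + card F2"
    using oospc_finite[OF F1] oospc_finite[OF F2] by (simp add: card_Un_disjoint card_image)
qed

section \<open>Regularity and assembly of the construction\<close>

lemma mon_image_subgroup:
  assumes "f \<in> mon G H" "group G" "group H" "subgroup K G"
  shows "subgroup (f ` K) H" and "card (f ` K) = card K"
proof -
  interpret group_hom G H f
    using assms by (simp add: mon_def group_hom_def group_hom_axioms_def)
  show "subgroup (f ` K) H" using assms(4) by (rule subgroup_img_is_subgroup)
  show "card (f ` K) = card K"
    using assms by (intro card_image) (auto simp: mon_def dest: subgroup.subset intro: inj_on_subset)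
qed

theorem mainTheorem4:
  fixes m n s t k la b1 b2 :: nat
    and F1 F2 :: "(int \<times> int) set set"
  assumes "2 \<le> k"
    and "oospc m n k la 1 F1" and "oospc_regular m n s t F1" and "card F1 = b1"
    and "oospc s t k la 1 F2" and "card F2 = b2"
  shows "\<exists>F. oospc m n k la 1 F \<and> card F = b1 + b2 \<and>
             (\<forall>g h. oospc_regular s t g h F2 \<longrightarrow> oospc_regular m n g h F)"
proof -
  have "0 < m" "0 < n" using assms(2) by (auto simp: oospc_def)
  obtain S T where S: "subgroup S (integer_mod_group m)" "card S = s"
    and T: "subgroup T (integer_mod_group n)" "card T = t"
    and L: "insert \<one>\<^bsub>ZZ m n\<^esub> (leave m n F1) = S \<times> T"
    using assms(3) unfolding oospc_regular_def by blast
  obtain f1 where f1: "f1 \<in> mon (integer_mod_group s) (integer_mod_group m)"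
    "f1 ` carrier (integer_mod_group s) = S"
    using integer_mod_group_subgroup_embedding[OF S \<open>0 < m\<close>] .
  obtain f2 where f2: "f2 \<in> mon (integer_mod_group t) (integer_mod_group n)"
    "f2 ` carrier (integer_mod_group t) = T"
    using integer_mod_group_subgroup_embedding[OF T \<open>0 < n\<close>] .
  \<comment> \<open>Acting componentwise, \<open>\<phi>\<close> maps the small group onto
    \<open>S \<times> T\<close>, which is the leave of \<open>F1\<close> together with zero.\<close>
  define \<phi> where "\<phi> = map_prod f1 f2"
  define F where "F = F1 \<union> image \<phi> ` F2"
  have "\<phi> \<in> hom (ZZ s t) (ZZ m n)"
    using f1(1) f2(1) unfolding \<phi>_def map_prod_def mon_def by (simp add: hom_paired2)
  then have hom: "group_hom (ZZ s t) (ZZ m n) \<phi>"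
    by (simp add: group_hom_def group_hom_axioms_def group_ZZ)
  have inj: "inj_on \<phi> (carrier (ZZ s t))"
    using f1(1) f2(1) by (simp add: \<phi>_def mon_def map_prod_inj_on)
  have im: "insert \<one>\<^bsub>ZZ m n\<^esub> (leave m n F1) = \<phi> ` carrier (ZZ s t)"
    using L f1(2) f2(2) by (simp add: \<phi>_def map_prod_surj_on)
  \<comment> \<open>\<open>F\<close> is fixed before \<open>g\<close> and \<open>h\<close>, so a
    single code inherits regularity for every such pair.\<close>
  have "oospc_regular m n g h F" if reg: "oospc_regular s t g h F2" for g h
  proof -
    obtain A B where A: "subgroup A (integer_mod_group s)" "card A = g"
      and B: "subgroup B (integer_mod_group t)" "card B = h"
      and AB: "insert \<one>\<^bsub>ZZ s t\<^esub> (leave s t F2) = A \<times> B"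
      using reg unfolding oospc_regular_def by blast
    have "leave m n F = \<phi> ` leave s t F2"
      unfolding F_def using assms(5) leave_Un_image[OF hom inj im] by (simp add: oospc_def)
    then have "insert \<one>\<^bsub>ZZ m n\<^esub> (leave m n F) = \<phi> ` insert \<one>\<^bsub>ZZ s t\<^esub> (leave s t F2)"
      using group_hom.hom_one[OF hom] by (metis image_insert)
    \<comment> \<open>The componentwise form of \<open>\<phi>\<close> keeps a product of subgroups a
      product, and injectivity of \<open>f1\<close> and \<open>f2\<close> preserves the orders of
      the factors.\<close>
    also have "\<dots> = (f1 ` A) \<times> (f2 ` B)"
      unfolding AB \<phi>_def by (simp add: map_prod_surj_on)
    finally show ?thesis
      unfolding oospc_regular_def
      using mon_image_subgroup[OF f1(1) _ _ A(1)] mon_image_subgroup[OF f2(1) _ _ B(1)] A(2) B(2)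
      by auto
  qed
  moreover have "oospc m n k la 1 F" "card F = b1 + b2"
    using oospc_Un_image[OF hom inj assms(1,2,5)] im assms(4,6) by (simp_all add: F_def)
  ultimately show ?thesis by blast
qed

end
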